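(* Let $F:\mathbb{R}^{m\times n}\to\mathbb{R}^{m\times n}$ (not necessarily a gradient field) be of class $C^3$ in a neighborhood of a simple zero $X^\ast$, with $A^\ast:=DF(X^\ast)$ invertible, $B^\ast:=D^2F(X^\ast)$, and $C^\ast:=D^3F(X^\ast)$. For the Newton map $\mathcal N(X):=X-DF(X)^{-1}F(X)$ and any direction $H\in\mathbb{R}^{m\times n}$, $$D\mathcal N(X^\ast)[H]=0,\qquad D^2\mathcal N(X^\ast)[H,H]=A^{\ast-1}B^\ast[H,H],$$ $$D^3\mathcal N(X^\ast)[H,H,H]=2\,A^{\ast-1}C^\ast[H,H,H]-3\,A^{\ast-1}B^\ast\big[H,\,A^{\ast-1}B^\ast[H,H]\big].$$
   Context: $DF(X)$, $D^2F(X)$, $D^3F(X)$ are the Fréchet derivatives of $F$: respectively a linear operator, a symmetric bilinear map and a symmetric trilinear map on $\mathbb{R}^{m\times n}$ with values in $\mathbb{R}^{m\times n}$. $A^{\ast-1}=(A^\ast)^{-1}$ is the inverse linear operator on $\mathbb{R}^{m\times n}$. A simple zero is a point $X^\ast$ with $F(X^\ast)=0$ and $DF(X^\ast)$ invertible. The Newton map is considered in a neighborhood of $X^\ast$ where $DF(X)$ is invertible. *)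

theory Defs
  imports "HOL-Analysis.Analysis"
begin

(* The Frechet derivative as a map into the normed space of bounded linear operators, so that
   it can be differentiated again.  Where f is not differentiable at x the value is arbitrary. *)
definition fderiv ::
  "('a::real_normed_vector \<Rightarrow> 'b::real_normed_vector) \<Rightarrow> 'a \<Rightarrow> 'a \<Rightarrow>\<^sub>L 'b" where
  "fderiv f x = Blinfun (frechet_derivative f (at x))"

(* fderiv2 f x h k is D^2 f(x)[h, k], and fderiv3 f x h k l is D^3 f(x)[h, k, l]:
   the direction of the last differentiation comes first. *)
abbreviation fderiv2 ::
  "('a::real_normed_vector \<Rightarrow> 'b::real_normed_vector) \<Rightarrow> 'a \<Rightarrow> 'a \<Rightarrow>\<^sub>L 'a \<Rightarrow>\<^sub>L 'b" where
  "fderiv2 f \<equiv> fderiv (fderiv f)"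

abbreviation fderiv3 ::
  "('a::real_normed_vector \<Rightarrow> 'b::real_normed_vector) \<Rightarrow> 'a \<Rightarrow> 'a \<Rightarrow>\<^sub>L 'a \<Rightarrow>\<^sub>L 'a \<Rightarrow>\<^sub>L 'b" where
  "fderiv3 f \<equiv> fderiv (fderiv2 f)"

definition C3_on ::
  "'a::real_normed_vector set \<Rightarrow> ('a \<Rightarrow> 'b::real_normed_vector) \<Rightarrow> bool" where
  "C3_on U f \<longleftrightarrow>
     (\<forall>x\<in>U. f differentiable (at x)) \<and>
     (\<forall>x\<in>U. fderiv f differentiable (at x)) \<and>
     (\<forall>x\<in>U. fderiv2 f differentiable (at x)) \<and>
     continuous_on U (fderiv3 f)"

definition thrice_differentiable_at ::
  "('a::real_normed_vector \<Rightarrow> 'b::real_normed_vector) \<Rightarrow> 'a \<Rightarrow> bool" where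
  "thrice_differentiable_at f x \<longleftrightarrow>
     (\<forall>\<^sub>F y in nhds x. f differentiable (at y)) \<and>
     (\<forall>\<^sub>F y in nhds x. fderiv f differentiable (at y)) \<and>
     fderiv2 f differentiable (at x)"

definition simple_zero ::
  "('a::real_normed_vector \<Rightarrow> 'b::real_normed_vector) \<Rightarrow> 'a \<Rightarrow> bool" where
  "simple_zero f x \<longleftrightarrow> f x = 0 \<and> f differentiable (at x) \<and> bij (blinfun_apply (fderiv f x))"

(* Meaningful only at points where the derivative is bijective. *)
definition newton_map ::
  "('a::real_normed_vector \<Rightarrow> 'a) \<Rightarrow> 'a \<Rightarrow> 'a" where
  "newton_map f x = x - inv (blinfun_apply (fderiv f x)) (f x)"

end

theory Submission
  imports Defs
begin

text \<open>
  Write \<open>G(Y)\<close> for the inverse of \<open>DF(Y)\<close>, and \<open>P(Y) = G(Y) F(Y)\<close> for the Newton step, so that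
  \<open>N(Y) = Y - P(Y)\<close> and \<open>P\<close> vanishes at the zero \<open>X\<close>. Since invertibility is an open condition and
  \<open>DG(Y)[k] = - G(Y) D\<^sup>2F(Y)[k] G(Y)\<close> (lemmas \<open>eventually_bij_blinfun\<close> and
  \<open>has_derivative_blinfun_inv\<close>), the product rule gives, for \<open>Y\<close> near \<open>X\<close>,

  \<open>DN(Y)[h] = G(Y) D\<^sup>2F(Y)[h, P(Y)]\<close>,

  \<open>D\<^sup>2N(Y)[k, h] = G(Y) D\<^sup>2F(Y)[h, k - DN(Y)[k]] + M(Y) P(Y)\<close>,

  with \<open>M(Y) = G(Y) D\<^sup>3F(Y)[k, h] - G(Y) D\<^sup>2F(Y)[k] G(Y) D\<^sup>2F(Y)[h]\<close>.
  The first two claims follow by setting \<open>Y = X\<close>.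

  The operator \<open>M\<close> contains \<open>D\<^sup>3F\<close>, which is only continuous, so the product rule does not apply
  to \<open>M(Y) P(Y)\<close>. But a continuous factor times a differentiable factor that vanishes at \<open>X\<close> is
  differentiable at \<open>X\<close>, and only the second factor contributes to the derivative
  (lemma \<open>has_derivative_blinfun_apply_zero\<close>). Hence \<open>D\<^sup>2N\<close> is differentiable at \<open>X\<close>, though
  possibly nowhere else. The derivative at \<open>X\<close> contains two terms with \<open>D\<^sup>3F\<close>, one from each summand
  of \<open>D\<^sup>2N\<close>, and three terms with two factors \<open>D\<^sup>2F\<close>: from \<open>M\<close>, from \<open>DG\<close>, and from \<open>DN\<close> in the
  argument of \<open>D\<^sup>2F\<close>. The symmetry of the higher derivatives is not needed, because the order of the
  arguments is tracked until all directions are equal.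
\<close>

section \<open>Derivatives with values in bounded linear operators\<close>

lemma fderiv_eqI:
  assumes "(f has_derivative f') (at x)"
  shows "blinfun_apply (fderiv f x) = f'"
proof -
  have "frechet_derivative f (at x) = f'"
    using assms by (metis frechet_derivative_at)
  then show ?thesis
    unfolding fderiv_def
    using has_derivative_bounded_linear[OF assms] by (simp add: bounded_linear_Blinfun_apply)
qed

lemma has_derivative_fderiv:
  assumes "f differentiable (at x)"
  shows "(f has_derivative blinfun_apply (fderiv f x)) (at x)"
  using assms fderiv_eqI unfolding differentiable_def by metis

lemma has_derivative_fderiv_component:
  fixes f :: "'a::real_normed_vector \<Rightarrow> 'b::real_normed_vector \<Rightarrow>\<^sub>L 'c::real_normed_vector"
  assumes "f differentiable (at x)"
  shows "((\<lambda>y. f y h) has_derivative (\<lambda>k. fderiv f x k h)) (at x)"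
  by (rule bounded_linear.has_derivative[OF blinfun.bounded_linear_left has_derivative_fderiv[OF assms]])

lemma fderiv_component_eqI:
  fixes f :: "'a::real_normed_vector \<Rightarrow> 'b::real_normed_vector \<Rightarrow>\<^sub>L 'c::real_normed_vector"
  assumes "f differentiable (at x)" and "((\<lambda>y. f y h) has_derivative D) (at x)"
  shows "fderiv f x k h = D k"
  using has_derivative_unique[OF has_derivative_fderiv_component[OF assms(1)] assms(2)]
  by metis

text \<open>
  An operator-valued map on a finite-dimensional space is differentiable as soon as its values on
  fixed vectors are. This reduces every differentiability claim about \<open>DN\<close> and \<open>D\<^sup>2N\<close> to an
  expression in which the directions are fixed.
\<close>

lemma differentiable_blinfun_componentwise:
  fixes f :: "'a::real_normed_vector \<Rightarrow> 'b::euclidean_space \<Rightarrow>\<^sub>L 'c::real_normed_vector"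
  assumes "\<And>h. (\<lambda>y. f y h) differentiable (at x)"
  shows "f differentiable (at x)"
proof -
  have eq: "f = (\<lambda>y. \<Sum>i\<in>Basis. blinfun_scaleR_left (f y i) o\<^sub>L blinfun_inner_left i)"
  proof (rule ext, rule blinfun_eqI)
    fix y h
    have "f y h = f y (\<Sum>i\<in>Basis. (h \<bullet> i) *\<^sub>R i)"
      by (simp add: euclidean_representation)
    also have "\<dots> = (\<Sum>i\<in>Basis. (h \<bullet> i) *\<^sub>R f y i)"
      by (simp add: blinfun.sum_right blinfun.scaleR_right)
    finally show "f y h = (\<Sum>i\<in>Basis. blinfun_scaleR_left (f y i) o\<^sub>L blinfun_inner_left i) h"
      by (simp add: blinfun.sum_left inner_commute)
  qed
  have "(\<lambda>y. blinfun_scaleR_left (f y i) o\<^sub>L blinfun_inner_left i) differentiable (at x)" for i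
  proof -
    obtain D where "((\<lambda>y. f y i) has_derivative D) (at x)"
      using assms unfolding differentiable_def by blast
    from bounded_linear.has_derivative[OF bounded_linear_compose[OF
          bounded_bilinear.bounded_linear_left[OF bounded_bilinear_blinfun_compose]
          bounded_linear_blinfun_scaleR_left] this]
    show ?thesis unfolding differentiable_def by blast
  qed
  then show ?thesis
    by (subst eq) (intro differentiable_sum, auto)
qed

section \<open>Inversion of bounded linear operators\<close>

text \<open>
  The inverse of an operator, again as a bounded linear operator. The value is meaningful only
  where the operator is bijective and its inverse is bounded; the latter is automatic in finite
  dimension.
\<close>

definition blinfun_inv :: "('a::real_normed_vector \<Rightarrow>\<^sub>L 'a) \<Rightarrow> 'a \<Rightarrow>\<^sub>L 'a" where
  "blinfun_inv A = Blinfun (inv (blinfun_apply A))"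

lemma blinfun_apply_inv:
  fixes A :: "'a::euclidean_space \<Rightarrow>\<^sub>L 'a"
  assumes "bij (blinfun_apply A)"
  shows "blinfun_apply (blinfun_inv A) = inv (blinfun_apply A)"
proof -
  have "linear (inv (blinfun_apply A))"
    using assms by (intro inj_linear_imp_inv_linear)
      (auto simp: bij_def blinfun.bounded_linear_right intro: bounded_linear.linear)
  then show ?thesis
    unfolding blinfun_inv_def
    by (intro bounded_linear_Blinfun_apply) (simp add: linear_linear)
qed

lemma blinfun_inv_cancel:
  fixes A :: "'a::euclidean_space \<Rightarrow>\<^sub>L 'a"
  assumes "bij (blinfun_apply A)"
  shows "A (blinfun_inv A x) = x" "blinfun_inv A (A x) = x"
  using assms by (simp_all add: blinfun_apply_inv bij_def surj_f_inv_f)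

text \<open>
  An operator \<open>T\<close> close to an invertible \<open>A\<close> is bounded below. In finite dimension this already makes
  it bijective, and the lower bound for \<open>T\<close> is an upper bound for its inverse.
\<close>

lemma near_bij_blinfun:
  fixes A :: "'a::euclidean_space \<Rightarrow>\<^sub>L 'a"
  assumes bij: "bij (blinfun_apply A)"
    and near: "norm (T - A) * norm (blinfun_inv A) \<le> 1 / 2"
  shows "bij (blinfun_apply T)" "norm (blinfun_inv T) \<le> 2 * norm (blinfun_inv A)"
proof -
  let ?c = "norm (blinfun_inv A)"
  have lower: "norm x \<le> 2 * ?c * norm (T x)" for x
  proof -
    have "x = blinfun_inv A (T x) - blinfun_inv A ((T - A) x)"
      by (simp add: blinfun.diff_left blinfun.diff_right blinfun_inv_cancel[OF bij])
    then have "norm x \<le> norm (blinfun_inv A (T x)) + norm (blinfun_inv A ((T - A) x))"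
      by (metis norm_triangle_ineq4)
    also have "\<dots> \<le> ?c * norm (T x) + ?c * (norm (T - A) * norm x)"
      by (intro add_mono norm_blinfun order_trans[OF norm_blinfun mult_left_mono]) auto
    also have "\<dots> \<le> ?c * norm (T x) + 1 / 2 * norm x"
      using mult_right_mono[OF near norm_ge_zero[of x]] by (simp add: mult_ac)
    finally show ?thesis by simp
  qed
  have lin: "linear (blinfun_apply T)"
    by (simp add: blinfun.bounded_linear_right bounded_linear.linear)
  have "inj (blinfun_apply T)"
    unfolding linear_injective_0[OF lin] using lower by (metis mult_zero_right norm_le_zero_iff norm_zero)
  then show bT: "bij (blinfun_apply T)"
    using lin by (simp add: bij_def linear_injective_imp_surjective)
  show "norm (blinfun_inv T) \<le> 2 * ?c"
    using lower[of "blinfun_inv T _"]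
    by (intro norm_blinfun_bound) (auto simp: blinfun_inv_cancel[OF bT])
qed

lemma eventually_near_bij_blinfun:
  fixes A :: "'a::euclidean_space \<Rightarrow>\<^sub>L 'a"
  shows "\<forall>\<^sub>F T in nhds A. norm (T - A) * norm (blinfun_inv A) \<le> 1 / 2"
proof -
  have "((\<lambda>T. norm (T - A) * norm (blinfun_inv A)) \<longlongrightarrow> norm (A - A) * norm (blinfun_inv A)) (nhds A)"
    by (intro tendsto_intros filterlim_ident)
  then have "\<forall>\<^sub>F T in nhds A. norm (T - A) * norm (blinfun_inv A) < 1 / 2"
    by (rule order_tendstoD) simp
  then show ?thesis
    by eventually_elim simp
qed

lemma eventually_bij_blinfun:
  fixes A :: "'a::euclidean_space \<Rightarrow>\<^sub>L 'a"
  assumes "bij (blinfun_apply A)"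
  shows "\<forall>\<^sub>F T in nhds A. bij (blinfun_apply T)"
  using eventually_near_bij_blinfun[of A] by eventually_elim (rule near_bij_blinfun[OF assms])

text \<open>
  The error of the linear approximation is exactly
  \<open>T\<^sup>-\<^sup>1 (T - A) A\<^sup>-\<^sup>1 (T - A) A\<^sup>-\<^sup>1\<close>, which is quadratic in \<open>T - A\<close> because \<open>T\<^sup>-\<^sup>1\<close> stays bounded
  near \<open>A\<close>.
\<close>

lemma has_derivative_blinfun_inv:
  fixes A :: "'a::euclidean_space \<Rightarrow>\<^sub>L 'a"
  assumes bij: "bij (blinfun_apply A)"
  shows "(blinfun_inv has_derivative (\<lambda>E. - (blinfun_inv A o\<^sub>L E o\<^sub>L blinfun_inv A))) (at A)"
proof -
  let ?G = "blinfun_inv A"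
  have bl: "bounded_linear (\<lambda>E. - (?G o\<^sub>L E o\<^sub>L ?G))"
    by (intro bounded_linear_minus bounded_linear_compose[OF
          bounded_bilinear.bounded_linear_left[OF bounded_bilinear_blinfun_compose]]
          bounded_bilinear.bounded_linear_right[OF bounded_bilinear_blinfun_compose])
  have bound: "norm (blinfun_inv T - ?G - - (?G o\<^sub>L (T - A) o\<^sub>L ?G)) / norm (T - A)
      \<le> 2 * norm ?G ^ 3 * norm (T - A)"
    if near: "norm (T - A) * norm ?G \<le> 1 / 2" for T
  proof -
    let ?S = "blinfun_inv T"
    note bT = near_bij_blinfun[OF bij near]
    have "?S - ?G - - (?G o\<^sub>L (T - A) o\<^sub>L ?G) = ?S o\<^sub>L (T - A) o\<^sub>L ?G o\<^sub>L (T - A) o\<^sub>L ?G"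
      by (rule blinfun_eqI)
        (simp add: blinfun.bilinear_simps blinfun_inv_cancel[OF bij] blinfun_inv_cancel[OF bT(1)])
    also have "norm \<dots> \<le> norm ?S * norm (T - A) * norm ?G * norm (T - A) * norm ?G"
      by (intro order_trans[OF norm_blinfun_compose mult_right_mono] norm_ge_zero order_refl)
    also have "\<dots> \<le> (2 * norm ?G) * norm (T - A) * norm ?G * norm (T - A) * norm ?G"
      by (intro mult_right_mono bT) auto
    finally have le: "norm (?S - ?G - - (?G o\<^sub>L (T - A) o\<^sub>L ?G))
        \<le> 2 * norm ?G ^ 3 * norm (T - A) * norm (T - A)"
      by (simp add: power3_eq_cube mult_ac)
    then show ?thesis
      by (cases "norm (T - A) = 0") (auto simp: divide_le_eq)
  qed
  have "((\<lambda>T. norm (blinfun_inv T - ?G - - (?G o\<^sub>L (T - A) o\<^sub>L ?G)) / norm (T - A)) \<longlongrightarrow> 0) (at A)"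
  proof (rule tendsto_sandwich[OF _ _ tendsto_const])
    show "\<forall>\<^sub>F T in at A. norm (blinfun_inv T - ?G - - (?G o\<^sub>L (T - A) o\<^sub>L ?G)) / norm (T - A)
        \<le> 2 * norm ?G ^ 3 * norm (T - A)"
      using eventually_nhds_conv_at[THEN iffD1, OF eventually_near_bij_blinfun[of A]] bound
      by (auto elim: eventually_mono)
    have "((\<lambda>T. 2 * norm ?G ^ 3 * norm (T - A)) \<longlongrightarrow> 2 * norm ?G ^ 3 * norm (A - A)) (at A)"
      by (intro tendsto_intros)
    then show "((\<lambda>T. 2 * norm ?G ^ 3 * norm (T - A)) \<longlongrightarrow> 0) (at A)" by simp
  qed auto
  with bl show ?thesis
    by (simp add: has_derivative_iff_norm)
qed

section \<open>Products with a factor that vanishes\<close>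

lemma has_derivative_blinfun_apply_zero:
  fixes M :: "'a::real_normed_vector \<Rightarrow> 'b::real_normed_vector \<Rightarrow>\<^sub>L 'c::real_normed_vector"
  assumes M: "continuous (at x) M" and P: "(P has_derivative P') (at x)" and "P x = 0"
  shows "((\<lambda>y. M y (P y)) has_derivative (\<lambda>l. M x (P' l))) (at x)"
proof -
  have lim: "((\<lambda>y. (1 / norm (y - x)) *\<^sub>R (P y - (P x + P' (y - x)))) \<longlongrightarrow> 0) (at x)"
    and blP: "bounded_linear P'"
    using P by (auto simp: has_derivative_at2)
  obtain K where K: "\<And>h. norm (P' h) \<le> norm h * K"
    using bounded_linear.bounded[OF blP] by blast
  have Mx: "(M \<longlongrightarrow> M x) (at x)"
    using M by (simp add: continuous_within)
  have 1: "((\<lambda>y. M y ((1 / norm (y - x)) *\<^sub>R (P y - (P x + P' (y - x))))) \<longlongrightarrow> M x 0) (at x)"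
    by (intro tendsto_intros Mx lim)
  \<comment> \<open>The linear part of \<open>P\<close> is \<open>O(y - x)\<close>, so replacing \<open>M y\<close> by \<open>M x\<close> in front of it costs only
    \<open>o(y - x)\<close>. This is where continuity of \<open>M\<close> suffices.\<close>
  have 2: "((\<lambda>y. (M y - M x) ((1 / norm (y - x)) *\<^sub>R P' (y - x))) \<longlongrightarrow> 0) (at x)"
  proof (rule Lim_null_comparison)
    have "((\<lambda>y. norm (M y - M x) * K) \<longlongrightarrow> norm (M x - M x) * K) (at x)"
      by (intro tendsto_intros Mx)
    then show "((\<lambda>y. norm (M y - M x) * K) \<longlongrightarrow> 0) (at x)" by simp
    have "norm ((M y - M x) ((1 / norm (y - x)) *\<^sub>R P' (y - x))) \<le> norm (M y - M x) * K"
      if "y \<noteq> x" for y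
    proof (rule order_trans[OF norm_blinfun mult_left_mono])
      show "norm ((1 / norm (y - x)) *\<^sub>R P' (y - x)) \<le> K"
        using K[of "y - x"] that by (simp add: divide_le_eq mult_ac)
    qed simp
    then show "\<forall>\<^sub>F y in at x. norm ((M y - M x) ((1 / norm (y - x)) *\<^sub>R P' (y - x)))
        \<le> norm (M y - M x) * K"
      by (auto simp: eventually_at_filter)
  qed
  have "((\<lambda>y. (1 / norm (y - x)) *\<^sub>R (M y (P y) - (M x (P x) + M x (P' (y - x))))) \<longlongrightarrow> 0) (at x)"
    using tendsto_add[OF 1 2] \<open>P x = 0\<close> by (simp add: blinfun.bilinear_simps algebra_simps)
  moreover have "bounded_linear (\<lambda>l. M x (P' l))"
    using bounded_linear_compose[OF blinfun.bounded_linear_right blP] .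
  ultimately show ?thesis
    by (simp add: has_derivative_at2)
qed

section \<open>Derivatives of the Newton map\<close>

text \<open>
  The three derivatives in arbitrary directions. Since \<open>fderiv2 f x h k\<close> lists the direction of the
  last differentiation first, \<open>D\<^sup>2N[k, h]\<close> comes out as \<open>G (D\<^sup>2F[h, k])\<close>, with the arguments exchanged.
\<close>

lemma newton_map_derivatives:
  fixes F :: "'a::euclidean_space \<Rightarrow> 'a"
  assumes "open U" and "X \<in> U" and "C3_on U F" and "simple_zero F X"
  defines "G \<equiv> blinfun_inv (fderiv F X)" and "B \<equiv> fderiv2 F X" and "C \<equiv> fderiv3 F X"
  shows "\<forall>\<^sub>F Y in nhds X. bij (blinfun_apply (fderiv F Y))"
    and "thrice_differentiable_at (newton_map F) X"
    and "fderiv (newton_map F) X h = 0"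
    and "fderiv2 (newton_map F) X k h = G (B h k)"
    and "fderiv3 (newton_map F) X l k h =
      G (C l h k) + G (C k h l) - G (B l (G (B h k))) - G (B k (G (B h l))) - G (B h (G (B k l)))"
proof -
  define A where "A = fderiv F"
  define g where "g Y = blinfun_inv (A Y)" for Y
  define p where "p Y = g Y (F Y)" for Y
  define b where "b = fderiv A"
  define c where "c = fderiv b"
  let ?N = "newton_map F"
  have dF: "(F has_derivative A Y) (at Y)" and dA: "(A has_derivative b Y) (at Y)"
    and db: "b differentiable (at Y)" if "Y \<in> U" for Y
    using that \<open>C3_on U F\<close> unfolding C3_on_def A_def b_def
    by (auto intro: has_derivative_fderiv)
  have c_cont: "continuous (at X) c"
    using assms(1-3) unfolding C3_on_def A_def b_def c_def
    by (simp add: continuous_on_eq_continuous_at)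
  have FX: "F X = 0" and bijX: "bij (A X)"
    using \<open>simple_zero F X\<close> by (auto simp: simple_zero_def A_def)
  have "isCont A X"
    using dA[OF \<open>X \<in> U\<close>] by (rule has_derivative_continuous)
  then have "\<forall>\<^sub>F Y in nhds X. bij (blinfun_apply (A Y))"
    using eventually_bij_blinfun[OF bijX]
    by (auto simp: isCont_def tendsto_at_iff_tendsto_nhds elim: eventually_compose_filterlim)
  then show ev: "\<forall>\<^sub>F Y in nhds X. bij (blinfun_apply (fderiv F Y))"
    by (simp add: A_def)
  obtain V where V: "open V" "X \<in> V" "V \<subseteq> U" "\<And>Y. Y \<in> V \<Longrightarrow> bij (A Y)"
  proof -
    obtain W where "open W" "X \<in> W" "\<forall>Y\<in>W. bij (A Y)"
      using ev unfolding eventually_nhds A_def by blast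
    then show thesis
      using that[of "W \<inter> U"] assms(1,2) by auto
  qed
  have evV: "\<forall>\<^sub>F Y in nhds X. Y \<in> V"
    using V by (simp add: eventually_nhds_in_open)
  have dg: "(g has_derivative (\<lambda>k. - (g Y o\<^sub>L b Y k o\<^sub>L g Y))) (at Y)" if "Y \<in> V" for Y
    unfolding g_def
    using has_derivative_compose[OF dA has_derivative_blinfun_inv] V that by auto
  have Neq: "?N Y = Y - p Y" if "Y \<in> V" for Y
    using V that by (simp add: newton_map_def p_def g_def blinfun_apply_inv A_def)
  have dp: "(p has_derivative (\<lambda>k. k - g Y (b Y k (p Y)))) (at Y)" if "Y \<in> V" for Y
  proof -
    have "((\<lambda>Y. g Y (F Y)) has_derivative
        (\<lambda>k. g Y (A Y k) + (- (g Y o\<^sub>L b Y k o\<^sub>L g Y)) (F Y))) (at Y)"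
      by (rule blinfun.FDERIV[OF dg[OF that] dF]) (use that V in auto)
    then show ?thesis
      using blinfun_inv_cancel(2)[OF V(4)[OF that]]
      by (simp add: p_def[abs_def] g_def blinfun.bilinear_simps)
  qed
  have dN: "(?N has_derivative (\<lambda>k. g Y (b Y k (p Y)))) (at Y)" if "Y \<in> V" for Y
  proof -
    have "((\<lambda>Y. Y - p Y) has_derivative (\<lambda>k. k - (k - g Y (b Y k (p Y))))) (at Y)"
      by (intro has_derivative_diff has_derivative_ident dp that)
    then have "((\<lambda>Y. Y - p Y) has_derivative (\<lambda>k. g Y (b Y k (p Y)))) (at Y)"
      by simp
    then show ?thesis
      by (rule has_derivative_transform_within_open[OF _ V(1) that]) (simp add: Neq)
  qed
  have N1: "fderiv ?N Y h = g Y (b Y h (p Y))" if "Y \<in> V" for Y h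
    using fderiv_eqI[OF dN[OF that]] by simp
  have dbc: "((\<lambda>Y. b Y h) has_derivative (\<lambda>k. c Y k h)) (at Y)" if "Y \<in> V" for Y h
    unfolding c_def using has_derivative_fderiv_component[OF db] V that by blast
  \<comment> \<open>The second derivative is split so that the only occurrence of \<open>c\<close>, which need not be
    differentiable, is in an operator applied to \<open>p Y\<close>.\<close>
  define r where "r Y k h = g Y (b Y h (k - fderiv ?N Y k))
    + ((g Y o\<^sub>L c Y k h) - (g Y o\<^sub>L b Y k o\<^sub>L g Y o\<^sub>L b Y h)) (p Y)" for Y k h
  have dN1: "((\<lambda>Y. fderiv ?N Y h) has_derivative (\<lambda>k. r Y k h)) (at Y)" if "Y \<in> V" for Y h
  proof -
    have "((\<lambda>Y. g Y (b Y h (p Y))) has_derivative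
       (\<lambda>k. g Y (b Y h (k - g Y (b Y k (p Y))) + c Y k h (p Y))
          + (- (g Y o\<^sub>L b Y k o\<^sub>L g Y)) (b Y h (p Y)))) (at Y)"
      by (rule blinfun.FDERIV[OF dg[OF that] blinfun.FDERIV[OF dbc[OF that] dp[OF that]]])
    moreover have "g Y (b Y h (k - g Y (b Y k (p Y))) + c Y k h (p Y))
          + (- (g Y o\<^sub>L b Y k o\<^sub>L g Y)) (b Y h (p Y)) = r Y k h" for k
      by (simp add: r_def N1[OF that] blinfun.bilinear_simps)
    ultimately have "((\<lambda>Y. g Y (b Y h (p Y))) has_derivative (\<lambda>k. r Y k h)) (at Y)"
      by simp
    then show ?thesis
      by (rule has_derivative_transform_within_open[OF _ V(1) that]) (simp add: N1)
  qed
  have diffN1: "fderiv ?N differentiable (at Y)" if "Y \<in> V" for Y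
    by (rule differentiable_blinfun_componentwise) (use dN1[OF that] in \<open>auto simp: differentiable_def\<close>)
  have N2: "fderiv2 ?N Y k h = r Y k h" if "Y \<in> V" for Y k h
    by (rule fderiv_component_eqI[OF diffN1 dN1]) (use that in auto)
  have pX: "p X = 0" by (simp add: p_def FX)
  have N1X: "fderiv ?N X k = 0" for k
    by (simp add: N1 V pX)
  have N2X: "fderiv2 ?N X k h = g X (b X h k)" for k h
    by (simp add: N2 V r_def pX N1X)
  \<comment> \<open>The first line differentiates \<open>g\<close>, \<open>b\<close> and \<open>fderiv ?N\<close> in the first summand of \<open>r\<close>; the second
    line is the operator in the second summand of \<open>r\<close> applied to \<open>l\<close>, as \<open>p\<close> has derivative
    the identity at \<open>X\<close>.\<close>
  define s where "s l k h = g X (b X h (- g X (b X k l)) + c X l h k) - g X (b X l (g X (b X h k)))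
    + (g X (c X k h l) - g X (b X k (g X (b X h l))))" for l k h
  have dN2: "((\<lambda>Y. fderiv2 ?N Y k h) has_derivative (\<lambda>l. s l k h)) (at X)" for k h
  proof -
    let ?M = "\<lambda>Y. (g Y o\<^sub>L c Y k h) - (g Y o\<^sub>L b Y k o\<^sub>L g Y o\<^sub>L b Y h)"
    have cg: "continuous (at X) g" and cb: "\<And>h. continuous (at X) (\<lambda>Y. b Y h)"
      using dg[OF V(2)] dbc[OF V(2)] by (auto intro: has_derivative_continuous)
    have cM: "continuous (at X) ?M"
      by (intro continuous_intros cg cb c_cont)
    have 1: "((\<lambda>Y. ?M Y (p Y)) has_derivative
        (\<lambda>l. ?M X (l - g X (b X l (p X))))) (at X)"
      by (rule has_derivative_blinfun_apply_zero[OF cM dp[OF V(2)] pX])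
    have "((\<lambda>Y. k - fderiv ?N Y k) has_derivative (\<lambda>l. 0 - r X l k)) (at X)"
      by (intro has_derivative_diff has_derivative_const dN1 V)
    from has_derivative_add[OF blinfun.FDERIV[OF dg[OF V(2)] blinfun.FDERIV[OF dbc[OF V(2)] this]] 1]
    have "((\<lambda>Y. r Y k h) has_derivative (\<lambda>l. s l k h)) (at X)"
      using N2[OF V(2)] N2X N1X pX
      by (simp add: r_def[abs_def] s_def blinfun.bilinear_simps)
    then show ?thesis
      by (rule has_derivative_transform_within_open[OF _ V(1,2)]) (simp add: N2)
  qed
  have diffN2k: "(\<lambda>Y. fderiv2 ?N Y k) differentiable (at X)" for k
    by (rule differentiable_blinfun_componentwise) (use dN2 in \<open>auto simp: differentiable_def\<close>)
  have diffN2: "fderiv2 ?N differentiable (at X)"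
    by (rule differentiable_blinfun_componentwise) (rule diffN2k)
  show "thrice_differentiable_at ?N X"
    unfolding thrice_differentiable_at_def
    using evV dN diffN1 diffN2 by (auto simp: differentiable_def elim!: eventually_mono)
  show "fderiv ?N X h = 0" by (rule N1X)
  show "fderiv2 ?N X k h = G (B h k)"
    by (simp add: N2X G_def B_def g_def b_def A_def)
  have "((\<lambda>Y. fderiv2 ?N Y k h) has_derivative (\<lambda>l. fderiv3 ?N X l k h)) (at X)"
    by (rule bounded_linear.has_derivative[OF blinfun.bounded_linear_left
          has_derivative_fderiv_component[OF diffN2]])
  from has_derivative_unique[OF this dN2] have "fderiv3 ?N X l k h = s l k h"
    by metis
  then show "fderiv3 ?N X l k h =
      G (C l h k) + G (C k h l) - G (B l (G (B h k))) - G (B k (G (B h l))) - G (B h (G (B k l)))"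
    by (simp add: s_def G_def B_def C_def g_def b_def A_def c_def blinfun.bilinear_simps)
qed

theorem proposition5:
  fixes F :: "real ^ 'n ^ 'm \<Rightarrow> real ^ 'n ^ 'm"
    and U :: "(real ^ 'n ^ 'm) set"
    and X H :: "real ^ 'n ^ 'm"
  assumes "open U" and "X \<in> U" and "C3_on U F" and "simple_zero F X"
  shows "(\<forall>\<^sub>F Y in nhds X. bij (blinfun_apply (fderiv F Y))) \<and>
    thrice_differentiable_at (newton_map F) X \<and>
    fderiv (newton_map F) X H = 0 \<and>
    fderiv2 (newton_map F) X H H = inv (fderiv F X) (fderiv2 F X H H) \<and>
    fderiv3 (newton_map F) X H H H =
      2 *\<^sub>R inv (fderiv F X) (fderiv3 F X H H H)
      - 3 *\<^sub>R inv (fderiv F X) (fderiv2 F X H (inv (fderiv F X) (fderiv2 F X H H)))"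
proof -
  have "bij (blinfun_apply (fderiv F X))"
    using assms(4) by (simp add: simple_zero_def)
  note inv_eq = blinfun_apply_inv[OF this]
  have three: "3 *\<^sub>R v = v + v + v" for v :: "real ^ 'n ^ 'm"
    using scaleR_left_distrib[of 2 1 v] by (simp add: scaleR_2)
  show ?thesis
    using newton_map_derivatives[OF assms]
    by (auto simp: inv_eq scaleR_2 three diff_diff_eq)
qed

end
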